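(* Let $T_1^2$ be a second-order theory in a finite relational vocabulary $\{R_1,\ldots,R_n\}$, $R_i$ of arity $r_i$. Let $R'_1,\ldots,R'_n$ be new relation symbols with $R'_i$ of arity $r_i$, and let $T_2^2$ be $T_1^2$ with every occurrence of $R_i$ replaced by $R'_i$. Let $F$ be a new unary function symbol and $U,U'$ new unary predicate symbols, and let $\mathrm{ISO}(F,U,U')$ be the first-order formula saying that $F$ is a bijection between $U$ and $U'$ such that $R_i(a_1,\ldots,a_{r_i})\leftrightarrow R'_i(F(a_1),\ldots,F(a_{r_i}))$ for all $a_1,\ldots,a_{r_i}\in U$ and all $1\le i\le n$. For a second-order formula $\phi$, let $\phi^{(U)}$ be $\phi$ with all first- and second-order quantifiers relativized to $U$, and $T^{(U)}=\{\phi^{(U)}:\phi\in T\}$. Suppose $T_1^2$ is internally categorical, i.e. $$T_1^{2(U)}\cup T_2^{2(U')}\vdash_2\exists F\,\mathrm{ISO}(F,U,U').$$ Then $T_1^2$ is categorical: if $M$ and $M'$ are full models of $T_1^2$, then $M\cong M'$.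
   Context: $\vdash_2$ denotes derivability in the usual deductive system of second-order logic: first-order axioms, introduction and elimination rules for second-order variables, and all instances of the comprehension and choice schemas. A second-order model is full if its second-order variables range over all relations (all subsets of the appropriate powers) of the domain. *)

theory Defs
  imports "HOL-Library.FuncSet"
begin

section \<open>Syntax of second-order logic over a relational vocabulary\<close>

text \<open>Relation and function variables carry their arity: \<open>RV k n\<close> is the \<open>n\<close>-th \<open>k\<close>-ary relation
  variable, \<open>FV k n\<close> the \<open>n\<close>-th \<open>k\<close>-ary function variable.\<close>

datatype var = IV nat | RV nat nat | FV nat nat

datatype tm = Var nat | App nat nat "tm list"

datatype 's prd = Sym 's | PVar nat nat

datatype 's fm =
    Bot
  | Eq tm tm
  | Atm "'s prd" "tm list"
  | Imp "'s fm" "'s fm"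
  | Forall var "'s fm"

abbreviation Neg :: "'s fm \<Rightarrow> 's fm" where
  "Neg \<phi> \<equiv> Imp \<phi> Bot"

abbreviation And :: "'s fm \<Rightarrow> 's fm \<Rightarrow> 's fm" where
  "And \<phi> \<psi> \<equiv> Neg (Imp \<phi> (Neg \<psi>))"

abbreviation Iff :: "'s fm \<Rightarrow> 's fm \<Rightarrow> 's fm" where
  "Iff \<phi> \<psi> \<equiv> And (Imp \<phi> \<psi>) (Imp \<psi> \<phi>)"

abbreviation Exists :: "var \<Rightarrow> 's fm \<Rightarrow> 's fm" where
  "Exists v \<phi> \<equiv> Neg (Forall v (Neg \<phi>))"

definition Foralls :: "nat list \<Rightarrow> 's fm \<Rightarrow> 's fm" where
  "Foralls xs \<phi> = foldr (\<lambda>x. Forall (IV x)) xs \<phi>"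

definition Ands :: "'s fm list \<Rightarrow> 's fm" where
  "Ands \<phi>s = foldr And \<phi>s (Neg Bot)"

text \<open>A vocabulary \<open>\<sigma>\<close> assigns an arity to each of its relation symbols and \<open>None\<close> to everything
  else.\<close>

type_synonym 's vocabulary = "'s \<Rightarrow> nat option"

fun wf_tm :: "tm \<Rightarrow> bool" where
  "wf_tm (Var x) = True"
| "wf_tm (App k g ts) = (length ts = k \<and> (\<forall>t\<in>set ts. wf_tm t))"

fun wf_prd :: "'s vocabulary \<Rightarrow> nat \<Rightarrow> 's prd \<Rightarrow> bool" where
  "wf_prd \<sigma> k (Sym s) = (\<sigma> s = Some k)"
| "wf_prd \<sigma> k (PVar l X) = (l = k)"

fun wf_fm :: "'s vocabulary \<Rightarrow> 's fm \<Rightarrow> bool" where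
  "wf_fm \<sigma> Bot = True"
| "wf_fm \<sigma> (Eq s t) = (wf_tm s \<and> wf_tm t)"
| "wf_fm \<sigma> (Atm p ts) = (wf_prd \<sigma> (length ts) p \<and> (\<forall>t\<in>set ts. wf_tm t))"
| "wf_fm \<sigma> (Imp \<phi> \<psi>) = (wf_fm \<sigma> \<phi> \<and> wf_fm \<sigma> \<psi>)"
| "wf_fm \<sigma> (Forall v \<phi>) = wf_fm \<sigma> \<phi>"

fun tm_vars :: "tm \<Rightarrow> var set" where
  "tm_vars (Var x) = {IV x}"
| "tm_vars (App k g ts) = insert (FV k g) (\<Union>t\<in>set ts. tm_vars t)"

fun prd_vars :: "'s prd \<Rightarrow> var set" where
  "prd_vars (Sym s) = {}"
| "prd_vars (PVar k X) = {RV k X}"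

fun fv :: "'s fm \<Rightarrow> var set" where
  "fv Bot = {}"
| "fv (Eq s t) = tm_vars s \<union> tm_vars t"
| "fv (Atm p ts) = prd_vars p \<union> (\<Union>t\<in>set ts. tm_vars t)"
| "fv (Imp \<phi> \<psi>) = fv \<phi> \<union> fv \<psi>"
| "fv (Forall v \<phi>) = fv \<phi> - {v}"

definition so_theory :: "'s vocabulary \<Rightarrow> 's fm set \<Rightarrow> bool" where
  "so_theory \<sigma> T \<longleftrightarrow> (\<forall>\<phi>\<in>T. wf_fm \<sigma> \<phi> \<and> fv \<phi> = {})"


section \<open>Substitution\<close>

text \<open>The three substitution functions do not rename bound variables; they are only used under the
  side condition \<open>free_for v W \<phi>\<close>: no free occurrence of \<open>v\<close> in \<open>\<phi>\<close> lies in the scope of a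
  quantifier that binds a variable from \<open>W\<close>.\<close>

fun free_for :: "var \<Rightarrow> var set \<Rightarrow> 's fm \<Rightarrow> bool" where
  "free_for v W Bot = True"
| "free_for v W (Eq s t) = True"
| "free_for v W (Atm p ts) = True"
| "free_for v W (Imp \<phi> \<psi>) = (free_for v W \<phi> \<and> free_for v W \<psi>)"
| "free_for v W (Forall u \<phi>) = (v \<notin> fv (Forall u \<phi>) \<or> (u \<notin> W \<and> free_for v W \<phi>))"

fun tm_subst :: "nat \<Rightarrow> tm \<Rightarrow> tm \<Rightarrow> tm" where
  "tm_subst x t (Var y) = (if y = x then t else Var y)"
| "tm_subst x t (App k g ts) = App k g (map (tm_subst x t) ts)"

fun subst :: "nat \<Rightarrow> tm \<Rightarrow> 's fm \<Rightarrow> 's fm" where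
  "subst x t Bot = Bot"
| "subst x t (Eq s s') = Eq (tm_subst x t s) (tm_subst x t s')"
| "subst x t (Atm p ts) = Atm p (map (tm_subst x t) ts)"
| "subst x t (Imp \<phi> \<psi>) = Imp (subst x t \<phi>) (subst x t \<psi>)"
| "subst x t (Forall v \<phi>) = Forall v (if v = IV x then \<phi> else subst x t \<phi>)"

fun rel_subst :: "nat \<Rightarrow> nat \<Rightarrow> 's prd \<Rightarrow> 's fm \<Rightarrow> 's fm" where
  "rel_subst k X p Bot = Bot"
| "rel_subst k X p (Eq s t) = Eq s t"
| "rel_subst k X p (Atm q ts) = Atm (if q = PVar k X then p else q) ts"
| "rel_subst k X p (Imp \<phi> \<psi>) = Imp (rel_subst k X p \<phi>) (rel_subst k X p \<psi>)"
| "rel_subst k X p (Forall v \<phi>) = Forall v (if v = RV k X then \<phi> else rel_subst k X p \<phi>)"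

fun tm_fun_subst :: "nat \<Rightarrow> nat \<Rightarrow> nat \<Rightarrow> tm \<Rightarrow> tm" where
  "tm_fun_subst k g h (Var y) = Var y"
| "tm_fun_subst k g h (App l f ts) =
     App l (if l = k \<and> f = g then h else f) (map (tm_fun_subst k g h) ts)"

fun fun_subst :: "nat \<Rightarrow> nat \<Rightarrow> nat \<Rightarrow> 's fm \<Rightarrow> 's fm" where
  "fun_subst k g h Bot = Bot"
| "fun_subst k g h (Eq s t) = Eq (tm_fun_subst k g h s) (tm_fun_subst k g h t)"
| "fun_subst k g h (Atm p ts) = Atm p (map (tm_fun_subst k g h) ts)"
| "fun_subst k g h (Imp \<phi> \<psi>) = Imp (fun_subst k g h \<phi>) (fun_subst k g h \<psi>)"
| "fun_subst k g h (Forall v \<phi>) = Forall v (if v = FV k g then \<phi> else fun_subst k g h \<phi>)"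


section \<open>The deductive system\<close>

text \<open>Classical natural deduction with equality. \<open>ForallI\<close> covers individual, relation and function
  variables alike. Existential rules and the remaining connectives are derived.

  \<open>Choice_ind\<close> is the schema \<open>\<forall>x \<exists>y \<phi>(x,y) \<longrightarrow> \<exists>G \<forall>x \<phi>(x,G(x))\<close> for tuples \<open>x\<close>;
  it also yields comprehension for functions. \<open>Choice_rel\<close> is the schema
  \<open>\<forall>x \<exists>Y \<phi>(x,Y) \<longrightarrow> \<exists>Z \<forall>x \<phi>(x,Z\<^sub>x)\<close>, where \<open>Z\<^sub>x = {y. Z(x,y)}\<close>; here \<open>\<phi>(x,Z\<^sub>x)\<close> is written as
  \<open>\<exists>Y (Y = Z\<^sub>x \<and> \<phi>(x,Y))\<close>.\<close>

inductive prv :: "'s vocabulary \<Rightarrow> 's fm set \<Rightarrow> 's fm \<Rightarrow> bool" for \<sigma> :: "'s vocabulary" where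
  Assm: "\<phi> \<in> \<Gamma> \<Longrightarrow> wf_fm \<sigma> \<phi> \<Longrightarrow> prv \<sigma> \<Gamma> \<phi>"
| Weaken: "prv \<sigma> \<Gamma> \<phi> \<Longrightarrow> \<Gamma> \<subseteq> \<Delta> \<Longrightarrow> prv \<sigma> \<Delta> \<phi>"
| ImpI: "wf_fm \<sigma> \<phi> \<Longrightarrow> prv \<sigma> (insert \<phi> \<Gamma>) \<psi> \<Longrightarrow> prv \<sigma> \<Gamma> (Imp \<phi> \<psi>)"
| ImpE: "prv \<sigma> \<Gamma> (Imp \<phi> \<psi>) \<Longrightarrow> prv \<sigma> \<Gamma> \<phi> \<Longrightarrow> prv \<sigma> \<Gamma> \<psi>"
| Class: "wf_fm \<sigma> \<phi> \<Longrightarrow> prv \<sigma> (insert (Neg \<phi>) \<Gamma>) Bot \<Longrightarrow> prv \<sigma> \<Gamma> \<phi>"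
| EqRefl: "wf_tm t \<Longrightarrow> prv \<sigma> \<Gamma> (Eq t t)"
| EqSubst: "prv \<sigma> \<Gamma> (Eq s t) \<Longrightarrow> prv \<sigma> \<Gamma> (subst x s \<phi>) \<Longrightarrow> wf_fm \<sigma> \<phi> \<Longrightarrow>
    free_for (IV x) (tm_vars s) \<phi> \<Longrightarrow> free_for (IV x) (tm_vars t) \<phi> \<Longrightarrow>
    prv \<sigma> \<Gamma> (subst x t \<phi>)"
| ForallI: "prv \<sigma> \<Gamma> \<phi> \<Longrightarrow> (\<forall>\<gamma>\<in>\<Gamma>. v \<notin> fv \<gamma>) \<Longrightarrow> prv \<sigma> \<Gamma> (Forall v \<phi>)"
| ForallE_ind: "prv \<sigma> \<Gamma> (Forall (IV x) \<phi>) \<Longrightarrow> wf_tm t \<Longrightarrow> free_for (IV x) (tm_vars t) \<phi> \<Longrightarrow>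
    prv \<sigma> \<Gamma> (subst x t \<phi>)"
| ForallE_rel: "prv \<sigma> \<Gamma> (Forall (RV k X) \<phi>) \<Longrightarrow> wf_prd \<sigma> k p \<Longrightarrow> free_for (RV k X) (prd_vars p) \<phi> \<Longrightarrow>
    prv \<sigma> \<Gamma> (rel_subst k X p \<phi>)"
| ForallE_fun: "prv \<sigma> \<Gamma> (Forall (FV k g) \<phi>) \<Longrightarrow> free_for (FV k g) {FV k h} \<phi> \<Longrightarrow>
    prv \<sigma> \<Gamma> (fun_subst k g h \<phi>)"
| Comprehension: "wf_fm \<sigma> \<phi> \<Longrightarrow> distinct xs \<Longrightarrow> length xs = k \<Longrightarrow> RV k X \<notin> fv \<phi> \<Longrightarrow>
    prv \<sigma> \<Gamma> (Exists (RV k X) (Foralls xs (Iff (Atm (PVar k X) (map Var xs)) \<phi>)))"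
| Choice_ind: "wf_fm \<sigma> \<phi> \<Longrightarrow> distinct (xs @ [y]) \<Longrightarrow> length xs = k \<Longrightarrow> FV k g \<notin> fv \<phi> \<Longrightarrow>
    free_for (IV y) (tm_vars (App k g (map Var xs))) \<phi> \<Longrightarrow>
    prv \<sigma> \<Gamma> (Imp (Foralls xs (Exists (IV y) \<phi>))
      (Exists (FV k g) (Foralls xs (subst y (App k g (map Var xs)) \<phi>))))"
| Choice_rel: "wf_fm \<sigma> \<phi> \<Longrightarrow> distinct (xs @ ys) \<Longrightarrow> length xs = k \<Longrightarrow> length ys = m \<Longrightarrow>
    RV (k + m) Z \<notin> insert (RV m Y) (fv \<phi>) \<Longrightarrow>
    prv \<sigma> \<Gamma> (Imp (Foralls xs (Exists (RV m Y) \<phi>))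
      (Exists (RV (k + m) Z) (Foralls xs (Exists (RV m Y)
        (And (Foralls ys (Iff (Atm (PVar m Y) (map Var ys))
                           (Atm (PVar (k + m) Z) (map Var (xs @ ys)))))
             \<phi>)))))"


section \<open>Semantics\<close>

definition tuples :: "'a set \<Rightarrow> nat \<Rightarrow> 'a list set" where
  "tuples D k = {xs. length xs = k \<and> set xs \<subseteq> D}"

text \<open>\<open>rels M k\<close> and \<open>funs M k\<close> are the ranges of the \<open>k\<close>-ary relation and function variables.\<close>

record ('s, 'a) so_model =
  carrier :: "'a set"
  interp :: "'s \<Rightarrow> 'a list set"
  rels :: "nat \<Rightarrow> 'a list set set"
  funs :: "nat \<Rightarrow> ('a list \<Rightarrow> 'a) set"

definition so_structure :: "'s vocabulary \<Rightarrow> ('s, 'a) so_model \<Rightarrow> bool" where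
  "so_structure \<sigma> M \<longleftrightarrow>
     carrier M \<noteq> {} \<and>
     (\<forall>s k. \<sigma> s = Some k \<longrightarrow> interp M s \<subseteq> tuples (carrier M) k) \<and>
     (\<forall>k. rels M k \<noteq> {} \<and> rels M k \<subseteq> Pow (tuples (carrier M) k)) \<and>
     (\<forall>k. funs M k \<noteq> {} \<and> funs M k \<subseteq> (tuples (carrier M) k \<rightarrow>\<^sub>E carrier M))"

definition full :: "('s, 'a) so_model \<Rightarrow> bool" where
  "full M \<longleftrightarrow> (\<forall>k. rels M k = Pow (tuples (carrier M) k) \<and>
                    funs M k = (tuples (carrier M) k \<rightarrow>\<^sub>E carrier M))"

fun tm_val :: "(nat \<Rightarrow> 'a) \<Rightarrow> (nat \<times> nat \<Rightarrow> 'a list \<Rightarrow> 'a) \<Rightarrow> tm \<Rightarrow> 'a" where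
  "tm_val e ef (Var x) = e x"
| "tm_val e ef (App k g ts) = ef (k, g) (map (tm_val e ef) ts)"

fun prd_val :: "('s, 'a) so_model \<Rightarrow> (nat \<times> nat \<Rightarrow> 'a list set) \<Rightarrow> 's prd \<Rightarrow> 'a list set" where
  "prd_val M er (Sym s) = interp M s"
| "prd_val M er (PVar k X) = er (k, X)"

fun sat :: "('s, 'a) so_model \<Rightarrow> (nat \<Rightarrow> 'a) \<Rightarrow> (nat \<times> nat \<Rightarrow> 'a list set) \<Rightarrow>
    (nat \<times> nat \<Rightarrow> 'a list \<Rightarrow> 'a) \<Rightarrow> 's fm \<Rightarrow> bool" where
  "sat M e er ef Bot = False"
| "sat M e er ef (Eq s t) = (tm_val e ef s = tm_val e ef t)"
| "sat M e er ef (Atm p ts) = (map (tm_val e ef) ts \<in> prd_val M er p)"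
| "sat M e er ef (Imp \<phi> \<psi>) = (sat M e er ef \<phi> \<longrightarrow> sat M e er ef \<psi>)"
| "sat M e er ef (Forall (IV x) \<phi>) = (\<forall>a\<in>carrier M. sat M (e(x := a)) er ef \<phi>)"
| "sat M e er ef (Forall (RV k X) \<phi>) = (\<forall>A\<in>rels M k. sat M e (er((k, X) := A)) ef \<phi>)"
| "sat M e er ef (Forall (FV k g) \<phi>) = (\<forall>f\<in>funs M k. sat M e er (ef((k, g) := f)) \<phi>)"

definition assignment :: "('s, 'a) so_model \<Rightarrow> (nat \<Rightarrow> 'a) \<Rightarrow> (nat \<times> nat \<Rightarrow> 'a list set) \<Rightarrow>
    (nat \<times> nat \<Rightarrow> 'a list \<Rightarrow> 'a) \<Rightarrow> bool" where
  "assignment M e er ef \<longleftrightarrow>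
     (\<forall>x. e x \<in> carrier M) \<and> (\<forall>k n. er (k, n) \<in> rels M k) \<and> (\<forall>k n. ef (k, n) \<in> funs M k)"

definition models :: "('s, 'a) so_model \<Rightarrow> 's fm set \<Rightarrow> bool" (infix \<open>\<Turnstile>\<close> 50) where
  "M \<Turnstile> T \<longleftrightarrow> (\<forall>\<phi>\<in>T. \<forall>e er ef. assignment M e er ef \<longrightarrow> sat M e er ef \<phi>)"

definition full_model_of :: "'s vocabulary \<Rightarrow> ('s, 'a) so_model \<Rightarrow> 's fm set \<Rightarrow> bool" where
  "full_model_of \<sigma> M T \<longleftrightarrow> so_structure \<sigma> M \<and> full M \<and> M \<Turnstile> T"

definition isomorphic :: "'s vocabulary \<Rightarrow> ('s, 'a) so_model \<Rightarrow> ('s, 'b) so_model \<Rightarrow> bool" where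
  "isomorphic \<sigma> M M' \<longleftrightarrow> (\<exists>f. bij_betw f (carrier M) (carrier M') \<and>
     (\<forall>s k. \<sigma> s = Some k \<longrightarrow>
       (\<forall>as\<in>tuples (carrier M) k. as \<in> interp M s \<longleftrightarrow> map f as \<in> interp M' s)))"


section \<open>Internal categoricity\<close>

text \<open>A finite relational vocabulary is given by the list \<open>rs\<close> of its arities: its symbols are
  \<open>0, \<dots>, length rs - 1\<close>, and symbol \<open>i\<close> has arity \<open>rs ! i\<close>.\<close>

definition voc :: "nat list \<Rightarrow> nat vocabulary" where
  "voc rs i = (if i < length rs then Some (rs ! i) else None)"

datatype xsym = Rel nat | Rel' nat | Us | Us'

fun xvoc :: "nat list \<Rightarrow> xsym vocabulary" where
  "xvoc rs (Rel i) = voc rs i"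
| "xvoc rs (Rel' i) = voc rs i"
| "xvoc rs Us = Some 1"
| "xvoc rs Us' = Some 1"

text \<open>\<open>guard u v\<close> says that the value of \<open>v\<close> lives on \<open>u\<close>: a relation is a set of tuples from \<open>u\<close>, and
  a function maps tuples from \<open>u\<close> into \<open>u\<close>.\<close>

fun guard :: "'s \<Rightarrow> var \<Rightarrow> 's fm" where
  "guard u (IV x) = Atm (Sym u) [Var x]"
| "guard u (RV k X) = Foralls [0..<k] (Imp (Atm (PVar k X) (map Var [0..<k]))
     (Ands (map (\<lambda>i. Atm (Sym u) [Var i]) [0..<k])))"
| "guard u (FV k g) = Foralls [0..<k] (Imp (Ands (map (\<lambda>i. Atm (Sym u) [Var i]) [0..<k]))
     (Atm (Sym u) [App k g (map Var [0..<k])]))"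

fun relativize :: "'s \<Rightarrow> 's fm \<Rightarrow> 's fm" where
  "relativize u Bot = Bot"
| "relativize u (Eq s t) = Eq s t"
| "relativize u (Atm p ts) = Atm p ts"
| "relativize u (Imp \<phi> \<psi>) = Imp (relativize u \<phi>) (relativize u \<psi>)"
| "relativize u (Forall v \<phi>) = Forall v (Imp (guard u v) (relativize u \<phi>))"

text \<open>In \<open>ISO rs F\<close> the function symbol is the unary function variable \<open>FV 1 F\<close>, so that it can be
  quantified.\<close>

definition ISO :: "nat list \<Rightarrow> nat \<Rightarrow> xsym fm" where
  "ISO rs F = (let
       U = (\<lambda>t. Atm (Sym Us) [t]);
       U' = (\<lambda>t. Atm (Sym Us') [t]);
       app = (\<lambda>t. App 1 F [t]);
       x = Var 0; y = Var 1 in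
     Ands
       ([Forall (IV 0) (Imp (U x) (U' (app x))),
         Forall (IV 0) (Forall (IV 1) (Imp (And (U x) (U y)) (Imp (Eq (app x) (app y)) (Eq x y)))),
         Forall (IV 1) (Imp (U' y) (Exists (IV 0) (And (U x) (Eq (app x) y))))] @
        map (\<lambda>i. let as = map Var [0..<rs ! i] in
              Foralls [0..<rs ! i] (Imp (Ands (map U as))
                (Iff (Atm (Sym (Rel i)) as) (Atm (Sym (Rel' i)) (map app as)))))
          [0..<length rs]))"

definition internally_categorical :: "nat list \<Rightarrow> nat fm set \<Rightarrow> bool" where
  "internally_categorical rs T \<longleftrightarrow>
     prv (xvoc rs)
       (relativize Us ` map_fm Rel ` T \<union> relativize Us' ` map_fm Rel' ` T)
       (Exists (FV 1 0) (ISO rs 0))"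

end

theory Submission
  imports Defs
begin

text \<open>The deductive system is sound for full structures. Given full models \<open>M\<close> and \<open>M'\<close> of the
  theory, interpret \<open>U\<close>, \<open>R\<^sub>i\<close> by \<open>M\<close> and \<open>U'\<close>, \<open>R'\<^sub>i\<close> by \<open>M'\<close> in the full structure on the disjoint
  union of the two carriers. Every relation and function on the part \<open>U\<close> is the trace of one on the
  whole union, so a relativized sentence holds in the union iff the sentence holds in the
  respective part. By soundness \<open>\<exists>F. ISO(F,U,U')\<close> holds in the union, and \<open>F\<close> restricted to \<open>U\<close> is an
  isomorphism.\<close>

section \<open>Coincidence and substitution\<close>

text \<open>Indexing by a set of variables lets one relation serve terms, predicates and formulas:
  it restricts to the variables of a part, and below a quantifier it grows by the bound
  variable.\<close>

definition agree :: "var set \<Rightarrow> (nat \<Rightarrow> 'a) \<Rightarrow> (nat \<times> nat \<Rightarrow> 'a list set) \<Rightarrow> (nat \<times> nat \<Rightarrow> 'a list \<Rightarrow> 'a) \<Rightarrow>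
    (nat \<Rightarrow> 'a) \<Rightarrow> (nat \<times> nat \<Rightarrow> 'a list set) \<Rightarrow> (nat \<times> nat \<Rightarrow> 'a list \<Rightarrow> 'a) \<Rightarrow> bool" where
  "agree V e er ef e' er' ef' \<longleftrightarrow>
     (\<forall>x. IV x \<in> V \<longrightarrow> e x = e' x) \<and>
     (\<forall>k X. RV k X \<in> V \<longrightarrow> er (k, X) = er' (k, X)) \<and>
     (\<forall>k g. FV k g \<in> V \<longrightarrow> ef (k, g) = ef' (k, g))"

lemma agree_mono: "agree V e er ef e' er' ef' \<Longrightarrow> W \<subseteq> V \<Longrightarrow> agree W e er ef e' er' ef'"
  unfolding agree_def by blast

lemma tm_val_cong: "agree (tm_vars t) e er ef e' er' ef' \<Longrightarrow> tm_val e ef t = tm_val e' ef' t"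
proof (induction t)
  case (Var x)
  then show ?case by (simp add: agree_def)
next
  case (App k g ts)
  have "map (tm_val e ef) ts = map (tm_val e' ef') ts"
  proof (rule map_cong[OF refl])
    fix t assume t: "t \<in> set ts"
    have "agree (tm_vars t) e er ef e' er' ef'"
      using App.prems by (rule agree_mono) (use t in auto)
    then show "tm_val e ef t = tm_val e' ef' t" by (rule App.IH[OF t])
  qed
  moreover have "ef (k, g) = ef' (k, g)" using App.prems by (simp add: agree_def)
  ultimately show ?case by (simp only: tm_val.simps)
qed

lemma tm_vals_cong:
  "agree (\<Union>t\<in>set ts. tm_vars t) e er ef e' er' ef' \<Longrightarrow> map (tm_val e ef) ts = map (tm_val e' ef') ts"
  by (rule map_cong[OF refl], rule tm_val_cong, erule agree_mono) auto

lemma prd_val_cong: "agree (prd_vars p) e er ef e' er' ef' \<Longrightarrow> prd_val M er p = prd_val M er' p"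
  by (cases p) (auto simp: agree_def)

text \<open>Coincidence lemma. At a quantifier both assignments receive the same new value, so
  agreement on \<open>fv \<phi> - {v}\<close> becomes agreement on \<open>fv \<phi>\<close>.\<close>

lemma sat_cong: "agree (fv \<phi>) e er ef e' er' ef' \<Longrightarrow> sat M e er ef \<phi> = sat M e' er' ef' \<phi>"
proof (induction \<phi> arbitrary: e er ef e' er' ef')
  case (Eq s t)
  have "tm_val e ef s = tm_val e' ef' s" "tm_val e ef t = tm_val e' ef' t"
    by (rule tm_val_cong, rule agree_mono[OF Eq], simp)+
  then show ?case by simp
next
  case (Atm p ts)
  have "prd_val M er p = prd_val M er' p"
    by (rule prd_val_cong, rule agree_mono[OF Atm], simp)
  moreover have "map (tm_val e ef) ts = map (tm_val e' ef') ts"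
    by (rule tm_vals_cong, rule agree_mono[OF Atm], simp)
  ultimately show ?case by (simp only: sat.simps)
next
  case (Imp \<phi> \<psi>)
  have "sat M e er ef \<phi> = sat M e' er' ef' \<phi>"
    by (rule Imp.IH(1), rule agree_mono[OF Imp.prems], simp)
  moreover have "sat M e er ef \<psi> = sat M e' er' ef' \<psi>"
    by (rule Imp.IH(2), rule agree_mono[OF Imp.prems], simp)
  ultimately show ?case by simp
next
  case (Forall v \<phi>)
  show ?case
  proof (cases v)
    case (IV x)
    have "sat M (e(x := a)) er ef \<phi> = sat M (e'(x := a)) er' ef' \<phi>" for a
      by (rule Forall.IH) (use Forall.prems IV in \<open>auto simp: agree_def\<close>)
    then show ?thesis using IV by simp
  next
    case (RV k X)
    have "sat M e (er((k, X) := A)) ef \<phi> = sat M e' (er'((k, X) := A)) ef' \<phi>" for A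
      by (rule Forall.IH) (use Forall.prems RV in \<open>auto simp: agree_def\<close>)
    then show ?thesis using RV by simp
  next
    case (FV k g)
    have "sat M e er (ef((k, g) := f)) \<phi> = sat M e' er' (ef'((k, g) := f)) \<phi>" for f
      by (rule Forall.IH) (use Forall.prems FV in \<open>auto simp: agree_def\<close>)
    then show ?thesis using FV by simp
  qed
qed simp

lemma sat_fresh_ind: "IV x \<notin> fv \<phi> \<Longrightarrow> sat M (e(x := a)) er ef \<phi> = sat M e er ef \<phi>"
  by (rule sat_cong) (auto simp: agree_def)

lemma sat_fresh_rel: "RV k X \<notin> fv \<phi> \<Longrightarrow> sat M e (er((k, X) := A)) ef \<phi> = sat M e er ef \<phi>"
  by (rule sat_cong) (auto simp: agree_def)

lemma sat_fresh_fun: "FV k g \<notin> fv \<phi> \<Longrightarrow> sat M e er (ef((k, g) := f)) \<phi> = sat M e er ef \<phi>"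
  by (rule sat_cong) (auto simp: agree_def)

lemma tm_val_fresh_ind: "IV x \<notin> tm_vars t \<Longrightarrow> tm_val (e(x := a)) ef t = tm_val e ef t"
  \<comment> \<open>Terms do not read the relation assignment, so any filler makes
    \<open>agree\<close> applicable.\<close>
  by (rule tm_val_cong[where er = "\<lambda>_. {}" and er' = "\<lambda>_. {}"]) (auto simp: agree_def)

lemma tm_val_fresh_fun: "FV k g \<notin> tm_vars t \<Longrightarrow> tm_val e (ef((k, g) := f)) t = tm_val e ef t"
  by (rule tm_val_cong[where er = "\<lambda>_. {}" and er' = "\<lambda>_. {}"]) (auto simp: agree_def)

section \<open>Substitution lemmas for individual, relation and function variables\<close>

lemma tm_val_subst: "tm_val e ef (tm_subst x t s) = tm_val (e(x := tm_val e ef t)) ef s"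
proof (induction s)
  case (App k g ts)
  then have "map (tm_val e ef) (map (tm_subst x t) ts) = map (tm_val (e(x := tm_val e ef t)) ef) ts"
    by (simp del: fun_upd_apply)
  then show ?case by (simp only: tm_subst.simps tm_val.simps)
qed simp

lemma tm_subst_fresh: "IV x \<notin> tm_vars s \<Longrightarrow> tm_subst x t s = s"
  by (induction s) (auto intro: map_idI)

lemma subst_fresh: "IV x \<notin> fv \<phi> \<Longrightarrow> subst x t \<phi> = \<phi>"
  by (induction \<phi>) (auto simp: tm_subst_fresh intro: map_idI)

text \<open>At a quantifier there are two cases. If \<open>x\<close> is not free, substitution and
  update both do nothing. Otherwise \<open>free_for\<close> keeps the bound variable distinct from
  \<open>x\<close> and out of \<open>t\<close>, so the two updates commute and the value of
  \<open>t\<close> is unaffected. The relation and function versions below follow the same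
  pattern.\<close>

lemma sat_subst:
  "free_for (IV x) (tm_vars t) \<phi> \<Longrightarrow>
   sat M e er ef (subst x t \<phi>) = sat M (e(x := tm_val e ef t)) er ef \<phi>"
proof (induction \<phi> arbitrary: e er ef)
  case (Atm p ts)
  have "map (tm_val e ef) (map (tm_subst x t) ts) = map (tm_val (e(x := tm_val e ef t)) ef) ts"
    by (simp add: tm_val_subst)
  then show ?case by (simp only: subst.simps sat.simps)
next
  case (Forall v \<phi>)
  show ?case
  proof (cases "IV x \<in> fv (Forall v \<phi>)")
    case False
    then show ?thesis by (simp only: subst_fresh sat_fresh_ind not_False_eq_True)
  next
    case True
    then have v: "v \<noteq> IV x" "v \<notin> tm_vars t" "free_for (IV x) (tm_vars t) \<phi>"
      using Forall.prems by auto
    show ?thesis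
      using v(1,2)
      by (cases v) (auto simp: Forall.IH[OF v(3)] tm_val_fresh_ind tm_val_fresh_fun fun_upd_twist
          simp del: fun_upd_apply)
  qed
qed (simp_all add: tm_val_subst)

lemma rel_subst_fresh: "RV k X \<notin> fv \<phi> \<Longrightarrow> rel_subst k X p \<phi> = \<phi>"
  by (induction \<phi>) auto

lemma prd_val_fresh: "RV k X \<notin> prd_vars p \<Longrightarrow> prd_val M (er((k, X) := A)) p = prd_val M er p"
  by (cases p) auto

lemma sat_rel_subst:
  "free_for (RV k X) (prd_vars p) \<phi> \<Longrightarrow>
   sat M e er ef (rel_subst k X p \<phi>) = sat M e (er((k, X) := prd_val M er p)) ef \<phi>"
proof (induction \<phi> arbitrary: e er ef)
  case (Atm q ts)
  then show ?case by (cases q) auto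
next
  case (Forall v \<phi>)
  show ?case
  proof (cases "RV k X \<in> fv (Forall v \<phi>)")
    case False
    then show ?thesis by (simp only: rel_subst_fresh sat_fresh_rel not_False_eq_True)
  next
    case True
    then have v: "v \<noteq> RV k X" "v \<notin> prd_vars p" "free_for (RV k X) (prd_vars p) \<phi>"
      using Forall.prems by auto
    show ?thesis
      using v(1,2)
      by (cases v) (auto simp: Forall.IH[OF v(3)] prd_val_fresh fun_upd_twist
          simp del: fun_upd_apply)
  qed
qed simp_all

lemma tm_val_fun_subst:
  "tm_val e ef (tm_fun_subst k g h s) = tm_val e (ef((k, g) := ef (k, h))) s"
proof (induction s)
  case (App l f ts)
  then have "map (tm_val e ef) (map (tm_fun_subst k g h) ts) = map (tm_val e (ef((k, g) := ef (k, h)))) ts"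
    by (simp del: fun_upd_apply)
  then show ?case by (simp only: tm_fun_subst.simps tm_val.simps) simp
qed simp

lemma tm_fun_subst_fresh: "FV k g \<notin> tm_vars s \<Longrightarrow> tm_fun_subst k g h s = s"
  by (induction s) (auto intro: map_idI)

lemma fun_subst_fresh: "FV k g \<notin> fv \<phi> \<Longrightarrow> fun_subst k g h \<phi> = \<phi>"
  by (induction \<phi>) (auto simp: tm_fun_subst_fresh intro: map_idI)

lemma sat_fun_subst:
  "free_for (FV k g) {FV k h} \<phi> \<Longrightarrow>
   sat M e er ef (fun_subst k g h \<phi>) = sat M e er (ef((k, g) := ef (k, h))) \<phi>"
proof (induction \<phi> arbitrary: e er ef)
  case (Atm p ts)
  have "map (tm_val e ef) (map (tm_fun_subst k g h) ts) = map (tm_val e (ef((k, g) := ef (k, h)))) ts"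
    by (simp add: tm_val_fun_subst)
  then show ?case by (simp only: fun_subst.simps sat.simps)
next
  case (Forall v \<phi>)
  show ?case
  proof (cases "FV k g \<in> fv (Forall v \<phi>)")
    case False
    then show ?thesis by (simp only: fun_subst_fresh sat_fresh_fun not_False_eq_True)
  next
    case True
    then have v: "v \<noteq> FV k g" "v \<noteq> FV k h" "free_for (FV k g) {FV k h} \<phi>"
      using Forall.prems by auto
    show ?thesis
    proof (cases v)
      case (FV l f)
      \<comment> \<open>The bound variable shares its assignment with both \<open>g\<close> and
        \<open>h\<close>: being different from \<open>(k, g)\<close> makes the updates commute, and
        being different from \<open>(k, h)\<close> preserves the substituted value.\<close>
      then have "(l, f) \<noteq> (k, g)" "(l, f) \<noteq> (k, h)" using v by auto
      then show ?thesis
        using FV by (auto simp: Forall.IH[OF v(3)] fun_upd_twist fun_upd_other simp del: fun_upd_apply)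
    qed (use v Forall.IH[OF v(3)] in \<open>auto simp del: fun_upd_apply\<close>)
  qed
qed (simp_all add: tm_val_fun_subst)


section \<open>Soundness for full structures\<close>

fun upds :: "(nat \<Rightarrow> 'a) \<Rightarrow> nat list \<Rightarrow> 'a list \<Rightarrow> nat \<Rightarrow> 'a" where
  "upds e (x # xs) (a # as) = upds (e(x := a)) xs as"
| "upds e xs as = e"

lemma upds_notin: "x \<notin> set xs \<Longrightarrow> upds e xs as x = e x"
  by (induction e xs as rule: upds.induct) auto

lemma map_upds_notin: "set ys \<inter> set xs = {} \<Longrightarrow> map (upds e xs as) ys = map e ys"
  by (rule map_cong) (auto intro: upds_notin)

text \<open>Updates are made one after the other, in the order in which \<open>Foralls\<close>
  strips its quantifiers. A repeated variable would keep only its last entry, whence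
  \<open>distinct\<close>.\<close>

lemma map_upds: "distinct xs \<Longrightarrow> length as = length xs \<Longrightarrow> map (upds e xs as) xs = as"
  by (induction e xs as rule: upds.induct) (auto simp: upds_notin)

lemma ball_tuples_Suc:
  "(\<forall>as\<in>tuples D (Suc k). P as) \<longleftrightarrow> (\<forall>a\<in>D. \<forall>as\<in>tuples D k. P (a # as))"
  by (auto simp: tuples_def length_Suc_conv)

lemma sat_Foralls:
  "sat M e er ef (Foralls xs \<phi>) \<longleftrightarrow>
   (\<forall>as\<in>tuples (carrier M) (length xs). sat M (upds e xs as) er ef \<phi>)"
proof (induction xs arbitrary: e)
  case Nil
  then show ?case by (simp add: Foralls_def tuples_def)
next
  case (Cons x xs)
  have "sat M e er ef (Foralls (x # xs) \<phi>) \<longleftrightarrow>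
      (\<forall>a\<in>carrier M. sat M (e(x := a)) er ef (Foralls xs \<phi>))"
    by (simp add: Foralls_def)
  also have "\<dots> \<longleftrightarrow> (\<forall>as\<in>tuples (carrier M) (length (x # xs)). sat M (upds e (x # xs) as) er ef \<phi>)"
    by (simp add: Cons.IH ball_tuples_Suc del: fun_upd_apply)
  finally show ?case .
qed

lemma sat_Ands: "sat M e er ef (Ands \<phi>s) \<longleftrightarrow> (\<forall>\<phi>\<in>set \<phi>s. sat M e er ef \<phi>)"
  by (induction \<phi>s) (auto simp: Ands_def)

lemma tm_vals_Var: "map (tm_val e ef) (map Var xs) = map e xs"
  by simp

text \<open>Needed to instantiate an individual quantifier by a term, whose value must lie in the
  range of the quantifier.\<close>

lemma tm_val_carrier:
  assumes "so_structure \<sigma> M" "assignment M e er ef"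
  shows "wf_tm t \<Longrightarrow> tm_val e ef t \<in> carrier M"
proof (induction t)
  case (App k g ts)
  have "ef (k, g) \<in> tuples (carrier M) k \<rightarrow>\<^sub>E carrier M"
    using assms unfolding so_structure_def assignment_def by blast
  moreover have "map (tm_val e ef) ts \<in> tuples (carrier M) k"
    using App by (auto simp: tuples_def)
  ultimately show ?case by auto
qed (use assms in \<open>auto simp: assignment_def\<close>)

section \<open>Validity of the comprehension and choice schemas\<close>

lemma comprehension_valid:
  assumes "full M" "distinct xs" "length xs = k" "RV k X \<notin> fv \<phi>"
  shows "sat M e er ef (Exists (RV k X) (Foralls xs (Iff (Atm (PVar k X) (map Var xs)) \<phi>)))"
proof -
  \<comment> \<open>The extension of \<open>\<phi>\<close> is the witness: fullness puts it in the
    range of \<open>X\<close>, and since \<open>X\<close> is not free in \<open>\<phi>\<close>,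
    assigning it does not change the extension.\<close>
  define A where "A = {as \<in> tuples (carrier M) k. sat M (upds e xs as) er ef \<phi>}"
  have "A \<in> rels M k" using assms(1) by (auto simp: full_def A_def)
  moreover have "sat M e (er((k, X) := A)) ef (Foralls xs (Iff (Atm (PVar k X) (map Var xs)) \<phi>))"
    unfolding sat_Foralls assms(3)
  proof
    fix as assume as: "as \<in> tuples (carrier M) k"
    then have "map (upds e xs as) xs = as" using assms by (auto intro!: map_upds simp: tuples_def)
    then show "sat M (upds e xs as) (er((k, X) := A)) ef (Iff (Atm (PVar k X) (map Var xs)) \<phi>)"
      using assms(4) as by (auto simp: sat_fresh_rel A_def comp_def)
  qed
  ultimately show ?thesis by auto
qed

text \<open>Choice in the metatheory selects a value for each tuple, and by fullness the selection
  is a value of \<open>g\<close>. Condition \<open>ff\<close> allows the substituted term to be read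
  as an update of \<open>y\<close>.\<close>

lemma choice_ind_valid:
  assumes "full M" "distinct (xs @ [y])" "length xs = k" "FV k g \<notin> fv \<phi>"
    and ff: "free_for (IV y) (tm_vars (App k g (map Var xs))) \<phi>"
  shows "sat M e er ef (Imp (Foralls xs (Exists (IV y) \<phi>))
      (Exists (FV k g) (Foralls xs (subst y (App k g (map Var xs)) \<phi>))))"
proof -
  have "\<exists>f\<in>funs M k. sat M e er (ef((k, g) := f)) (Foralls xs (subst y (App k g (map Var xs)) \<phi>))"
    if "sat M e er ef (Foralls xs (Exists (IV y) \<phi>))"
  proof -
    from that have "\<forall>as\<in>tuples (carrier M) k. \<exists>a\<in>carrier M. sat M ((upds e xs as)(y := a)) er ef \<phi>"
      by (simp add: sat_Foralls assms(3))
    then obtain c where c: "\<And>as. as \<in> tuples (carrier M) k \<Longrightarrow>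
        c as \<in> carrier M \<and> sat M ((upds e xs as)(y := c as)) er ef \<phi>"
      by metis
    \<comment> \<open>Members of \<open>funs\<close> are extensional, so \<open>c\<close> is cut
      down to tuples from the carrier.\<close>
    define f where "f = restrict c (tuples (carrier M) k)"
    have "f \<in> funs M k" using assms(1) c by (auto simp: full_def f_def)
    moreover have "sat M e er (ef((k, g) := f)) (Foralls xs (subst y (App k g (map Var xs)) \<phi>))"
      unfolding sat_Foralls assms(3)
    proof
      fix as assume as: "as \<in> tuples (carrier M) k"
      then have "map (upds e xs as) xs = as" using assms by (auto intro!: map_upds simp: tuples_def)
      then have "tm_val (upds e xs as) (ef((k, g) := f)) (App k g (map Var xs)) = c as"
        using as by (simp add: f_def comp_def)
      then show "sat M (upds e xs as) er (ef((k, g) := f)) (subst y (App k g (map Var xs)) \<phi>)"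
        using c[OF as] by (simp only: sat_subst[OF ff] sat_fresh_fun[OF assms(4)])
    qed
    ultimately show ?thesis by blast
  qed
  then show ?thesis by auto
qed

lemma choice_rel_valid:
  assumes "full M" "distinct (xs @ ys)" "length xs = k" "length ys = m"
    and fresh: "RV (k + m) Z \<notin> insert (RV m Y) (fv \<phi>)"
  shows "sat M e er ef (Imp (Foralls xs (Exists (RV m Y) \<phi>))
      (Exists (RV (k + m) Z) (Foralls xs (Exists (RV m Y)
        (And (Foralls ys (Iff (Atm (PVar m Y) (map Var ys))
                           (Atm (PVar (k + m) Z) (map Var (xs @ ys)))))
             \<phi>)))))"
proof -
  let ?D = "carrier M"
  let ?iff = "Iff (Atm (PVar m Y) (map Var ys)) (Atm (PVar (k + m) Z) (map Var (xs @ ys)))"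
  let ?body = "And (Foralls ys ?iff) \<phi>"
  have "\<exists>B\<in>rels M (k + m). sat M e (er((k + m, Z) := B)) ef (Foralls xs (Exists (RV m Y) ?body))"
    if "sat M e er ef (Foralls xs (Exists (RV m Y) \<phi>))"
  proof -
    from that have "\<forall>as\<in>tuples ?D k. \<exists>A\<in>rels M m. sat M (upds e xs as) (er((m, Y) := A)) ef \<phi>"
      by (simp add: sat_Foralls assms(3))
    then obtain c where c: "\<And>as. as \<in> tuples ?D k \<Longrightarrow>
        c as \<in> rels M m \<and> sat M (upds e xs as) (er((m, Y) := c as)) ef \<phi>"
      by metis
    \<comment> \<open>The family \<open>c\<close> is coded as a single relation. All first parts
      have length \<open>k\<close>, so \<open>as @ bs\<close> splits in only one way and the section
      of \<open>B\<close> at \<open>as\<close> is exactly \<open>c as\<close>.\<close>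
    define B where "B = {as @ bs | as bs. as \<in> tuples ?D k \<and> bs \<in> c as}"
    have cD: "c as \<subseteq> tuples ?D m" if "as \<in> tuples ?D k" for as
      using c[OF that] assms(1) by (auto simp: full_def)
    have B: "as @ bs \<in> B \<longleftrightarrow> bs \<in> c as" if "as \<in> tuples ?D k" for as bs
      using that by (auto simp: B_def tuples_def)
    have "B \<subseteq> tuples ?D (k + m)" using cD by (fastforce simp: B_def tuples_def)
    then have "B \<in> rels M (k + m)" using assms(1) by (simp add: full_def)
    moreover have "sat M e (er((k + m, Z) := B)) ef (Foralls xs (Exists (RV m Y) ?body))"
      unfolding sat_Foralls assms(3)
    proof
      fix as assume as: "as \<in> tuples ?D k"
      let ?er = "er((k + m, Z) := B, (m, Y) := c as)"
      \<comment> \<open>The arities differ unless \<open>k = 0\<close>; in that case the freshness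
        of \<open>Z\<close> keeps the two relation variables apart.\<close>
      have ne: "(k + m, Z) \<noteq> (m, Y)" using fresh by auto
      have "sat M (upds e xs as) ?er ef \<phi> = sat M (upds e xs as) (er((m, Y) := c as)) ef \<phi>"
        by (rule sat_cong) (use fresh in \<open>auto simp: agree_def\<close>)
      then have "sat M (upds e xs as) ?er ef \<phi>" using c[OF as] by simp
      moreover have "sat M (upds e xs as) ?er ef (Foralls ys ?iff)"
        unfolding sat_Foralls assms(4)
      proof
        fix bs assume bs: "bs \<in> tuples ?D m"
        let ?e = "upds (upds e xs as) ys bs"
        have "map ?e ys = bs" using bs assms by (auto intro!: map_upds simp: tuples_def)
        moreover have "map ?e xs = map (upds e xs as) xs"
          by (rule map_upds_notin) (use assms(2) in auto)
        moreover have "map (upds e xs as) xs = as"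
          using as assms by (auto intro!: map_upds simp: tuples_def)
        ultimately have "map (tm_val ?e ef) (map Var ys) = bs"
          "map (tm_val ?e ef) (map Var (xs @ ys)) = as @ bs"
          by (simp_all only: tm_vals_Var map_append)
        then show "sat M ?e ?er ef ?iff" using B[OF as] ne by auto
      qed
      ultimately have "sat M (upds e xs as) ?er ef ?body" by simp
      moreover have "c as \<in> rels M m" using c[OF as] by simp
      ultimately show "sat M (upds e xs as) (er((k + m, Z) := B)) ef (Exists (RV m Y) ?body)"
        unfolding sat.simps by blast
    qed
    ultimately show ?thesis by blast
  qed
  then show ?thesis unfolding sat.simps by blast
qed

section \<open>Soundness of the derivation rules\<close>

lemma assignment_upd:
  assumes "assignment M e er ef"
  shows "a \<in> carrier M \<Longrightarrow> assignment M (e(x := a)) er ef"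
    and "A \<in> rels M k \<Longrightarrow> assignment M e (er((k, X) := A)) ef"
    and "f \<in> funs M k \<Longrightarrow> assignment M e er (ef((k, g) := f))"
  using assms by (auto simp: assignment_def)

text \<open>Induction on derivations with the assignment generalized: in \<open>ForallI\<close> the
  eigenvariable may take any value, because the hypotheses do not contain it free. The elimination
  rules reduce to the substitution lemmas once the substituted value is known to lie in the range of
  the quantifier.\<close>

theorem soundness:
  assumes M: "so_structure \<sigma> M" "full M"
  shows "prv \<sigma> \<Gamma> \<phi> \<Longrightarrow> assignment M e er ef \<Longrightarrow> \<forall>\<gamma>\<in>\<Gamma>. sat M e er ef \<gamma> \<Longrightarrow> sat M e er ef \<phi>"
proof (induction arbitrary: e er ef rule: prv.induct)
  case (Weaken \<Gamma> \<phi> \<Delta>)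
  then show ?case by blast
next
  case (Class \<phi> \<Gamma>)
  then show ?case by fastforce
next
  case (EqSubst \<Gamma> s t x \<phi>)
  then have "tm_val e ef s = tm_val e ef t" "sat M e er ef (subst x s \<phi>)" by auto
  then show ?case by (simp add: sat_subst EqSubst.hyps)
next
  case (ForallI \<Gamma> \<phi> v)
  show ?case
  proof (cases v)
    case (IV x)
    have "sat M (e(x := a)) er ef \<phi>" if "a \<in> carrier M" for a
      by (rule ForallI.IH) (use ForallI that IV in
        \<open>auto simp: assignment_upd sat_fresh_ind simp del: fun_upd_apply\<close>)
    then show ?thesis using IV by simp
  next
    case (RV k X)
    have "sat M e (er((k, X) := A)) ef \<phi>" if "A \<in> rels M k" for A
      by (rule ForallI.IH) (use ForallI that RV in
        \<open>auto simp: assignment_upd sat_fresh_rel simp del: fun_upd_apply\<close>)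
    then show ?thesis using RV by simp
  next
    case (FV k g)
    have "sat M e er (ef((k, g) := f)) \<phi>" if "f \<in> funs M k" for f
      by (rule ForallI.IH) (use ForallI that FV in
        \<open>auto simp: assignment_upd sat_fresh_fun simp del: fun_upd_apply\<close>)
    then show ?thesis using FV by simp
  qed
next
  case (ForallE_ind \<Gamma> x \<phi> t)
  have "tm_val e ef t \<in> carrier M"
    using tm_val_carrier[OF M(1) ForallE_ind.prems(1)] ForallE_ind.hyps by blast
  then show ?case using ForallE_ind.IH[OF ForallE_ind.prems] by (simp add: sat_subst ForallE_ind.hyps)
next
  case (ForallE_rel \<Gamma> k X \<phi> p)
  \<comment> \<open>A variable has its value in the range by \<open>assignment\<close>; a symbol
    denotes a set of tuples, which is in the range by fullness.\<close>
  have "prd_val M er p \<in> rels M k"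
    using M ForallE_rel.hyps(2) ForallE_rel.prems(1)
    by (cases p) (auto simp: full_def so_structure_def assignment_def)
  then show ?case using ForallE_rel.IH[OF ForallE_rel.prems]
    by (simp add: sat_rel_subst ForallE_rel.hyps)
next
  case (ForallE_fun \<Gamma> k g \<phi> h)
  have "ef (k, h) \<in> funs M k" using ForallE_fun.prems by (simp add: assignment_def)
  then show ?case using ForallE_fun.IH[OF ForallE_fun.prems]
    by (simp add: sat_fun_subst ForallE_fun.hyps)
next
  case (Comprehension \<phi> xs k X \<Gamma>)
  then show ?case by (intro comprehension_valid M)
next
  case (Choice_ind \<phi> xs y k g \<Gamma>)
  then show ?case by (intro choice_ind_valid M)
next
  case (Choice_rel \<phi> xs ys k m Z Y \<Gamma>)
  then show ?case by (intro choice_rel_valid M)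
qed auto


section \<open>Relativization\<close>

lemma tuples_image: "tuples (h ` D) k = map h ` tuples D k"
proof
  show "tuples (h ` D) k \<subseteq> map h ` tuples D k"
  proof
    fix bs assume "bs \<in> tuples (h ` D) k"
    then have "bs \<in> lists (h ` D)" "length bs = k" by (auto simp: tuples_def)
    then obtain as where "bs = map h as" "as \<in> lists D" by (auto simp: lists_image)
    then show "bs \<in> map h ` tuples D k" using \<open>length bs = k\<close> by (auto simp: tuples_def)
  qed
qed (auto simp: tuples_def subset_iff)

text \<open>This conjunction is the form in which the guards and \<open>ISO\<close> say that a tuple
  lies in the part \<open>u\<close>.\<close>

lemma sat_Ands_in:
  assumes "length as = k"
  shows "sat N (upds e [0..<k] as) er ef (Ands (map (\<lambda>i. Atm (Sym u) [Var i]) [0..<k])) \<longleftrightarrow>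
    (\<forall>a\<in>set as. [a] \<in> interp N u)"
proof -
  have "set as = upds e [0..<k] as ` set [0..<k]"
    by (subst (1) map_upds[of "[0..<k]" as e, symmetric]) (use assms in simp_all)
  then show ?thesis by (auto simp: sat_Ands)
qed

text \<open>Abstracts one half of the disjoint union: \<open>h\<close> copies \<open>M\<close> onto
  the part of \<open>N\<close> cut out by \<open>u\<close>, and \<open>r\<close> renames the
  symbols. Both halves are instances, so the transfer of truth is proved once.\<close>

locale embedding =
  fixes \<sigma> :: "'s vocabulary" and M :: "('s, 'a) so_model" and N :: "('t, 'c) so_model"
    and h :: "'a \<Rightarrow> 'c" and r :: "'s \<Rightarrow> 't" and u :: 't
  assumes struct: "so_structure \<sigma> M" and full: "full M" and full': "full N"
    and inj: "inj h"
    and sub: "h ` carrier M \<subseteq> carrier N"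
    and interp_u: "\<And>b. [b] \<in> interp N u \<longleftrightarrow> b \<in> h ` carrier M"
    and interp_r: "\<And>s k. \<sigma> s = Some k \<Longrightarrow> interp N (r s) = map h ` interp M s"
begin

text \<open>Relations must be exact images, but functions are compared only on tuples from the copy,
  since a guard leaves their values elsewhere open.\<close>

definition corr :: "var set \<Rightarrow> (nat \<Rightarrow> 'a) \<Rightarrow> (nat \<times> nat \<Rightarrow> 'a list set) \<Rightarrow> (nat \<times> nat \<Rightarrow> 'a list \<Rightarrow> 'a) \<Rightarrow>
    (nat \<Rightarrow> 'c) \<Rightarrow> (nat \<times> nat \<Rightarrow> 'c list set) \<Rightarrow> (nat \<times> nat \<Rightarrow> 'c list \<Rightarrow> 'c) \<Rightarrow> bool" where
  "corr V e er ef e' er' ef' \<longleftrightarrow>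
     (\<forall>x. IV x \<in> V \<longrightarrow> e x \<in> carrier M \<and> e' x = h (e x)) \<and>
     (\<forall>k X. RV k X \<in> V \<longrightarrow> er' (k, X) = map h ` er (k, X)) \<and>
     (\<forall>k g. FV k g \<in> V \<longrightarrow> (\<forall>as\<in>tuples (carrier M) k.
        ef (k, g) as \<in> carrier M \<and> ef' (k, g) (map h as) = h (ef (k, g) as)))"

lemma corr_mono: "corr V e er ef e' er' ef' \<Longrightarrow> W \<subseteq> V \<Longrightarrow> corr W e er ef e' er' ef'"
  unfolding corr_def by blast

text \<open>Membership in \<open>carrier M\<close> is carried through the induction because
  \<open>corr\<close> relates functions only at arguments from there.\<close>

lemma tm_val_corr:
  "wf_tm t \<Longrightarrow> corr (tm_vars t) e er ef e' er' ef' \<Longrightarrow>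
   tm_val e ef t \<in> carrier M \<and> tm_val e' ef' t = h (tm_val e ef t)"
proof (induction t)
  case (Var x)
  then show ?case by (simp add: corr_def)
next
  case (App k g ts)
  have IH: "tm_val e ef t \<in> carrier M \<and> tm_val e' ef' t = h (tm_val e ef t)" if "t \<in> set ts" for t
    using that App.prems(1)
    by (intro App.IH corr_mono[OF App.prems(2)]) auto
  then have "map (tm_val e' ef') ts = map h (map (tm_val e ef) ts)"
    by simp
  moreover have "map (tm_val e ef) ts \<in> tuples (carrier M) k"
    using IH App.prems(1) by (auto simp: tuples_def)
  ultimately show ?case using App.prems(2) by (simp add: corr_def del: map_map)
qed

lemma sat_guard_rel:
  assumes "A \<in> rels N k"
  shows "sat N e (er((k, X) := A)) ef (guard u (RV k X)) \<longleftrightarrow> A \<subseteq> map h ` tuples (carrier M) k"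
proof -
  \<comment> \<open>The guard speaks only of tuples over \<open>carrier N\<close>, so it controls
    all of \<open>A\<close> only because \<open>A\<close> consists of such tuples.\<close>
  have A: "A \<subseteq> tuples (carrier N) k" using assms full' by (auto simp: full_def)
  have "sat N e (er((k, X) := A)) ef (guard u (RV k X)) \<longleftrightarrow>
    (\<forall>as\<in>tuples (carrier N) k. as \<in> A \<longrightarrow> (\<forall>a\<in>set as. a \<in> h ` carrier M))"
    by (auto simp: sat_Foralls sat_Ands_in interp_u map_upds tuples_def comp_def)
  also have "\<dots> \<longleftrightarrow> A \<subseteq> tuples (h ` carrier M) k"
    using A by (auto simp: tuples_def)
  finally show ?thesis by (simp add: tuples_image)
qed

lemma sat_guard_fun:
  "sat N e er (ef((k, g) := f)) (guard u (FV k g)) \<longleftrightarrow>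
    (\<forall>as\<in>tuples (carrier M) k. f (map h as) \<in> h ` carrier M)"
proof -
  have "sat N e er (ef((k, g) := f)) (guard u (FV k g)) \<longleftrightarrow>
    (\<forall>as\<in>tuples (carrier N) k. (\<forall>a\<in>set as. a \<in> h ` carrier M) \<longrightarrow> f as \<in> h ` carrier M)"
    by (auto simp: sat_Foralls sat_Ands_in interp_u map_upds tuples_def comp_def)
  also have "\<dots> \<longleftrightarrow> (\<forall>as\<in>tuples (h ` carrier M) k. f as \<in> h ` carrier M)"
    using sub by (auto simp: tuples_def subset_iff)
  finally show ?thesis by (simp add: tuples_image)
qed

text \<open>Together with \<open>fun_extend\<close> this gives back and forth between guarded
  functions of \<open>N\<close> and functions of \<open>M\<close>. There is no bijection in general,
  as one function on the copy may have many extensions.\<close>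

lemma fun_restrict:
  assumes "\<forall>as\<in>tuples (carrier M) k. f (map h as) \<in> h ` carrier M"
  obtains f0 where "f0 \<in> funs M k"
    "\<forall>as\<in>tuples (carrier M) k. f0 as \<in> carrier M \<and> f (map h as) = h (f0 as)"
proof
  let ?f0 = "\<lambda>as\<in>tuples (carrier M) k. inv h (f (map h as))"
  show *: "\<forall>as\<in>tuples (carrier M) k. ?f0 as \<in> carrier M \<and> f (map h as) = h (?f0 as)"
    using assms inj by fastforce
  then show "?f0 \<in> funs M k" using full by (auto simp: full_def)
qed

lemma fun_extend:
  assumes "f0 \<in> funs M k"
  obtains f where "f \<in> funs N k"
    "\<forall>as\<in>tuples (carrier M) k. f0 as \<in> carrier M \<and> f (map h as) = h (f0 as)"
proof -
  obtain c where c: "c \<in> carrier M" using struct by (auto simp: so_structure_def)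
  \<comment> \<open>On the copy \<open>f0\<close> is transported along \<open>h\<close>; on the
    remaining tuples of \<open>N\<close> the default \<open>h c\<close> keeps the values inside both
    the copy and \<open>carrier N\<close>.\<close>
  let ?f = "\<lambda>bs\<in>tuples (carrier N) k.
    if bs \<in> map h ` tuples (carrier M) k then h (f0 (map (inv h) bs)) else h c"
  have f0: "f0 as \<in> carrier M" if "as \<in> tuples (carrier M) k" for as
    using assms full that by (auto simp: full_def)
  have inv: "map (inv h) (map h as) = as" for as using inj by (simp add: comp_def)
  have N: "map h as \<in> tuples (carrier N) k" if "as \<in> tuples (carrier M) k" for as
    using sub that by (auto simp: tuples_def)
  have "\<forall>as\<in>tuples (carrier M) k. f0 as \<in> carrier M \<and> ?f (map h as) = h (f0 as)"
    using f0 N inv by (auto simp del: map_map)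
  moreover have "?f \<in> funs N k"
    using full' sub c f0 inv by (auto simp: full_def image_subset_iff simp del: map_map)
  ultimately show ?thesis using that by blast
qed

text \<open>Induction on the formula, with both assignments generalized. The guards cut the
  quantifier ranges of \<open>N\<close> down to objects that correspond to those of
  \<open>M\<close>; injectivity of \<open>h\<close> settles the atoms.\<close>

lemma sat_relativize:
  "wf_fm \<sigma> \<phi> \<Longrightarrow> corr (fv \<phi>) e er ef e' er' ef' \<Longrightarrow>
   sat N e' er' ef' (relativize u (map_fm r \<phi>)) \<longleftrightarrow> sat M e er ef \<phi>"
proof (induction \<phi> arbitrary: e er ef e' er' ef')
  case (Eq s t)
  have "tm_val e' ef' s = h (tm_val e ef s)" "tm_val e' ef' t = h (tm_val e ef t)"
    using Eq.prems(1) tm_val_corr corr_mono[OF Eq.prems(2), of "tm_vars s"]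
      corr_mono[OF Eq.prems(2), of "tm_vars t"] by auto
  then show ?case using inj by (simp add: inj_eq)
next
  case (Atm p ts)
  have "tm_val e' ef' t = h (tm_val e ef t)" if "t \<in> set ts" for t
    using tm_val_corr[OF _ corr_mono[OF Atm.prems(2)]] Atm.prems(1) that by fastforce
  then have "map (tm_val e' ef') ts = map h (map (tm_val e ef) ts)" by simp
  moreover have "prd_val N er' (map_prd r p) = map h ` prd_val M er p"
    using Atm.prems by (cases p) (auto simp: corr_def interp_r)
  ultimately show ?case
    using inj by (simp add: inj_image_mem_iff del: map_map)
next
  case (Imp \<phi> \<psi>)
  then show ?case
    using corr_mono[OF Imp.prems(2), of "fv \<phi>"] corr_mono[OF Imp.prems(2), of "fv \<psi>"] by simp
next
  case (Forall v \<phi>)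
  have wf: "wf_fm \<sigma> \<phi>" using Forall.prems by simp
  show ?case
  proof (cases v)
    case (IV x)
    have "sat N (e'(x := h a)) er' ef' (relativize u (map_fm r \<phi>)) \<longleftrightarrow> sat M (e(x := a)) er ef \<phi>"
      if "a \<in> carrier M" for a
      using that IV Forall.prems(2) by (intro Forall.IH[OF wf]) (auto simp: corr_def)
    then show ?thesis using IV sub by (auto simp: interp_u)
  next
    case (RV k X)
    have IH: "sat N e' (er'((k, X) := map h ` A)) ef' (relativize u (map_fm r \<phi>)) \<longleftrightarrow>
        sat M e (er((k, X) := A)) ef \<phi>" for A
      using RV Forall.prems(2) by (intro Forall.IH[OF wf]) (auto simp: corr_def)
    have "sat N e' er' ef' (relativize u (map_fm r (Forall v \<phi>))) \<longleftrightarrow>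
      (\<forall>A\<in>rels N k. A \<subseteq> map h ` tuples (carrier M) k \<longrightarrow>
        sat N e' (er'((k, X) := A)) ef' (relativize u (map_fm r \<phi>)))"
      using RV sat_guard_rel by (simp del: guard.simps)
    also have "\<dots> \<longleftrightarrow> (\<forall>A\<in>rels M k. sat N e' (er'((k, X) := map h ` A)) ef' (relativize u (map_fm r \<phi>)))"
    proof -
      have "map h ` tuples (carrier M) k \<subseteq> tuples (carrier N) k"
        using sub by (auto simp: tuples_def subset_iff)
      \<comment> \<open>Fullness is used on both sides: every subset of the copied tuples is
        available in \<open>N\<close>, and each is the image of a relation available in
        \<open>M\<close>.\<close>
      then have "{A \<in> rels N k. A \<subseteq> map h ` tuples (carrier M) k} = Pow (map h ` tuples (carrier M) k)"
        using full' by (auto simp: full_def)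
      also have "\<dots> = (`) (map h) ` rels M k"
        using full by (simp add: full_def image_Pow_surj)
      finally have "{A \<in> rels N k. A \<subseteq> map h ` tuples (carrier M) k} = (`) (map h) ` rels M k" .
      then have "(\<forall>A\<in>{A \<in> rels N k. A \<subseteq> map h ` tuples (carrier M) k}. P A) \<longleftrightarrow>
          (\<forall>A\<in>rels M k. P (map h ` A))" for P
        by simp
      from this[of "\<lambda>A. sat N e' (er'((k, X) := A)) ef' (relativize u (map_fm r \<phi>))"]
      show ?thesis by (simp add: Ball_def imp_conjL)
    qed
    finally show ?thesis using RV IH by simp
  next
    case (FV k g)
    let ?\<phi> = "relativize u (map_fm r \<phi>)"
    \<comment> \<open>Stated for every related pair, so that it applies both to a chosen extension
      and to a restriction.\<close>
    have IH: "sat N e' er' (ef'((k, g) := f)) ?\<phi> \<longleftrightarrow> sat M e er (ef((k, g) := f0)) \<phi>"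
      if "\<forall>as\<in>tuples (carrier M) k. f0 as \<in> carrier M \<and> f (map h as) = h (f0 as)" for f f0
      using that FV Forall.prems(2) by (intro Forall.IH[OF wf]) (auto simp: corr_def)
    have "sat N e' er' ef' (relativize u (map_fm r (Forall v \<phi>))) \<longleftrightarrow>
      (\<forall>f\<in>funs N k. (\<forall>as\<in>tuples (carrier M) k. f (map h as) \<in> h ` carrier M) \<longrightarrow>
        sat N e' er' (ef'((k, g) := f)) ?\<phi>)"
      using FV sat_guard_fun by (simp del: guard.simps)
    also have "\<dots> \<longleftrightarrow> (\<forall>f0\<in>funs M k. sat M e er (ef((k, g) := f0)) \<phi>)"
    proof (intro iffI ballI impI)
      fix f0 assume *: "\<forall>f\<in>funs N k. (\<forall>as\<in>tuples (carrier M) k. f (map h as) \<in> h ` carrier M) \<longrightarrow>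
        sat N e' er' (ef'((k, g) := f)) ?\<phi>" and "f0 \<in> funs M k"
      from \<open>f0 \<in> funs M k\<close> obtain f where f: "f \<in> funs N k"
        "\<forall>as\<in>tuples (carrier M) k. f0 as \<in> carrier M \<and> f (map h as) = h (f0 as)"
        by (rule fun_extend)
      then have "sat N e' er' (ef'((k, g) := f)) ?\<phi>" using * by auto
      then show "sat M e er (ef((k, g) := f0)) \<phi>" using IH[OF f(2)] by simp
    next
      fix f assume *: "\<forall>f0\<in>funs M k. sat M e er (ef((k, g) := f0)) \<phi>"
        and "\<forall>as\<in>tuples (carrier M) k. f (map h as) \<in> h ` carrier M"
      from this(2) obtain f0 where "f0 \<in> funs M k"
        "\<forall>as\<in>tuples (carrier M) k. f0 as \<in> carrier M \<and> f (map h as) = h (f0 as)"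
        by (rule fun_restrict)
      then show "sat N e' er' (ef'((k, g) := f)) ?\<phi>" using * IH by blast
    qed
    finally show ?thesis using FV by simp
  qed
qed simp

end

text \<open>Since \<open>models\<close> quantifies over assignments, drawing a satisfaction fact
  from it requires at least one.\<close>

lemma assignment_exists:
  assumes "so_structure \<sigma> M"
  obtains e er ef where "assignment M e er ef"
proof -
  have "\<exists>a. a \<in> carrier M" "\<forall>k. \<exists>A. A \<in> rels M k" "\<forall>k. \<exists>f. f \<in> funs M k"
    using assms by (auto simp: so_structure_def)
  then obtain a A f where "a \<in> carrier M" "\<And>k. A k \<in> rels M k" "\<And>k. f k \<in> funs M k"
    by metis
  then have "assignment M (\<lambda>_. a) (\<lambda>(k, n). A k) (\<lambda>(k, n). f k)"
    by (simp add: assignment_def)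
  then show ?thesis by (rule that)
qed

text \<open>A sentence has no free variables, so \<open>corr\<close> holds between arbitrary
  assignments.\<close>

lemma (in embedding) sat_relativize_theory:
  assumes "so_theory \<sigma> T" "M \<Turnstile> T" "\<phi> \<in> T"
  shows "sat N e' er' ef' (relativize u (map_fm r \<phi>))"
proof -
  obtain e er ef where "assignment M e er ef"
    using struct by (rule assignment_exists)
  then have "sat M e er ef \<phi>" using assms by (auto simp: models_def)
  moreover have "corr (fv \<phi>) e er ef e' er' ef'" "wf_fm \<sigma> \<phi>"
    using assms by (auto simp: so_theory_def corr_def)
  ultimately show ?thesis using sat_relativize by blast
qed


section \<open>The disjoint union of two full models\<close>

text \<open>The sum type makes the copies disjoint and allows the carriers to have different types;
  each symbol lives inside a single copy.\<close>

fun sum_interp :: "(nat, 'a) so_model \<Rightarrow> (nat, 'b) so_model \<Rightarrow> xsym \<Rightarrow> ('a + 'b) list set" where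
  "sum_interp M M' (Rel i) = map Inl ` interp M i"
| "sum_interp M M' (Rel' i) = map Inr ` interp M' i"
| "sum_interp M M' Us = (\<lambda>a. [Inl a]) ` carrier M"
| "sum_interp M M' Us' = (\<lambda>b. [Inr b]) ` carrier M'"

definition sum_model :: "(nat, 'a) so_model \<Rightarrow> (nat, 'b) so_model \<Rightarrow> (xsym, 'a + 'b) so_model" where
  "sum_model M M' = (let D = carrier M <+> carrier M' in
     \<lparr>carrier = D, interp = sum_interp M M', rels = (\<lambda>k. Pow (tuples D k)),
      funs = (\<lambda>k. tuples D k \<rightarrow>\<^sub>E D)\<rparr>)"

lemma sum_model_simps [simp]:
  "carrier (sum_model M M') = carrier M <+> carrier M'"
  "interp (sum_model M M') = sum_interp M M'"
  "rels (sum_model M M') k = Pow (tuples (carrier M <+> carrier M') k)"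
  "funs (sum_model M M') k = (tuples (carrier M <+> carrier M') k \<rightarrow>\<^sub>E carrier M <+> carrier M')"
  by (simp_all add: sum_model_def Let_def)

lemma full_sum_model: "full (sum_model M M')"
  by (simp add: full_def)

lemma structure_sum_model:
  assumes "so_structure (voc rs) M" "so_structure (voc rs) M'"
  shows "so_structure (xvoc rs) (sum_model M M')"
proof -
  have "sum_interp M M' s \<subseteq> tuples (carrier M <+> carrier M') k" if "xvoc rs s = Some k" for s k
  proof (cases s)
    case (Rel i)
    then have "interp M i \<subseteq> tuples (carrier M) k" using that assms by (auto simp: so_structure_def)
    then show ?thesis using Rel by (fastforce simp: tuples_def)
  next
    case (Rel' i)
    then have "interp M' i \<subseteq> tuples (carrier M') k" using that assms by (auto simp: so_structure_def)
    then show ?thesis using Rel' by (fastforce simp: tuples_def)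
  qed (use that in \<open>auto simp: tuples_def\<close>)
  moreover obtain c where "c \<in> carrier M" using assms by (auto simp: so_structure_def)
  \<comment> \<open>A constant function shows that the range of the function variables is non-empty
    at every arity.\<close>
  then have "(\<lambda>as\<in>tuples (carrier M <+> carrier M') k. Inl c)
      \<in> tuples (carrier M <+> carrier M') k \<rightarrow>\<^sub>E carrier M <+> carrier M'" for k
    by auto
  then have "tuples (carrier M <+> carrier M') k \<rightarrow>\<^sub>E carrier M <+> carrier M' \<noteq> {}" for k
    by blast
  moreover have "carrier M <+> carrier M' \<noteq> {}" using \<open>c \<in> carrier M\<close> by auto
  ultimately show ?thesis unfolding so_structure_def sum_model_simps by blast
qed

text \<open>The value of \<open>F\<close> maps left copies of elements to right copies; removing the
  tags yields the isomorphism.\<close>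

lemma isomorphic_if_sat_ISO:
  fixes M :: "(nat, 'a) so_model" and M' :: "(nat, 'b) so_model"
  assumes "sat (sum_model M M') e er ef (ISO rs F)"
  shows "isomorphic (voc rs) M M'"
proof -
  let ?N = "sum_model M M'"
  \<comment> \<open>\<open>G\<close> keeps the tagged value, since \<open>projr\<close> is
    informative only once the first conjunct of \<open>ISO\<close> shows that the tag is
    \<open>Inr\<close>.\<close>
  define G where "G a = ef (1, F) [Inl a]" for a
  define f where "f a = projr (G a)" for a
  have G: "G a \<in> Inr ` carrier M'" if "a \<in> carrier M" for a
    using assms that by (auto simp: ISO_def Let_def sat_Ands G_def)
  then have Gf: "G a = Inr (f a)" "f a \<in> carrier M'" if "a \<in> carrier M" for a
    using G[OF that] by (auto simp: f_def)
  have "\<forall>a\<in>carrier M. \<forall>b\<in>carrier M. G a = G b \<longrightarrow> a = b"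
    using assms by (auto simp: ISO_def Let_def sat_Ands G_def)
  then have "inj_on f (carrier M)" using Gf by (auto intro!: inj_onI)
  moreover have "\<exists>a\<in>carrier M. G a = Inr b" if "b \<in> carrier M'" for b
    using assms that by (auto simp: ISO_def Let_def sat_Ands G_def)
  then have "carrier M' \<subseteq> f ` carrier M" using Gf by (metis image_eqI subsetI sum.inject(2))
  ultimately have "bij_betw f (carrier M) (carrier M')"
    using Gf by (auto simp: bij_betw_def)
  moreover have "as \<in> interp M i \<longleftrightarrow> map f as \<in> interp M' i"
    if "voc rs i = Some k" and as: "as \<in> tuples (carrier M) k" for i k as
  proof -
    have i: "i < length rs" "rs ! i = k" using that by (auto simp: voc_def split: if_splits)
    let ?as = "map Inl as :: ('a + 'b) list"
    let ?e = "upds e [0..<k] ?as"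
    let ?app = "\<lambda>t. App 1 F [t]"
    have len: "length as = k" and asM: "set as \<subseteq> carrier M" using as by (auto simp: tuples_def)
    \<comment> \<open>This is the conjunct of \<open>ISO\<close> for symbol \<open>i\<close>, to be
      instantiated at the tagged tuple \<open>?as\<close>.\<close>
    have "sat ?N e er ef (Foralls [0..<k] (Imp (Ands (map (\<lambda>i. Atm (Sym Us) [Var i]) [0..<k]))
        (Iff (Atm (Sym (Rel i)) (map Var [0..<k])) (Atm (Sym (Rel' i)) (map ?app (map Var [0..<k]))))))"
      using assms i by (auto simp: ISO_def Let_def sat_Ands comp_def)
    moreover have "?as \<in> tuples (carrier ?N) k" using as by (auto simp: tuples_def)
    ultimately have "(\<forall>a\<in>set ?as. [a] \<in> interp ?N Us) \<longrightarrow>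
      (map ?e [0..<k] \<in> interp ?N (Rel i) \<longleftrightarrow>
       map (\<lambda>a. ef (1, F) [a]) (map ?e [0..<k]) \<in> interp ?N (Rel' i))"
      unfolding sat_Foralls length_upt diff_zero
      using sat_Ands_in[of ?as k ?N e er ef Us] len
      by (auto simp: comp_def)
    moreover have "map ?e [0..<k] = ?as" using len by (intro map_upds) auto
    \<comment> \<open>Entrywise application of \<open>F\<close> gives the right copy of
      \<open>map f as\<close>; as both taggings are injective, membership in the copied relations
      then becomes membership in the original ones.\<close>
    moreover have "map (\<lambda>a. ef (1, F) [a]) ?as = map Inr (map f as)"
      using asM Gf by (auto simp: G_def)
    ultimately show ?thesis
      using asM by (auto simp: inj_image_mem_iff simp del: map_map)
  qed
  ultimately show ?thesis unfolding isomorphic_def by blast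
qed

theorem theorem7:
  fixes rs :: "nat list" and T :: "nat fm set"
    and M :: "(nat, 'a) so_model" and M' :: "(nat, 'b) so_model"
  assumes "so_theory (voc rs) T"
    and "internally_categorical rs T"
    and "full_model_of (voc rs) M T"
    and "full_model_of (voc rs) M' T"
  shows "isomorphic (voc rs) M M'"
proof -
  let ?N = "sum_model M M'"
  have M: "so_structure (voc rs) M" "full M" "M \<Turnstile> T"
    and M': "so_structure (voc rs) M'" "full M'" "M' \<Turnstile> T"
    using assms by (auto simp: full_model_of_def)
  have N: "so_structure (xvoc rs) ?N" using M(1) M'(1) by (rule structure_sum_model)
  \<comment> \<open>The two halves of the union: \<open>L\<close> transfers the unprimed theory from
    \<open>M\<close>, and \<open>R\<close> the primed one from \<open>M'\<close>.\<close>
  interpret L: embedding "voc rs" M ?N Inl Rel Us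
    by unfold_locales (use M in \<open>auto simp: full_sum_model\<close>)
  interpret R: embedding "voc rs" M' ?N Inr Rel' Us'
    by unfold_locales (use M' in \<open>auto simp: full_sum_model\<close>)
  obtain e er ef where a: "assignment ?N e er ef" using N by (rule assignment_exists)
  have "sat ?N e er ef (Exists (FV 1 0) (ISO rs 0))"
  proof (rule soundness[OF N full_sum_model _ a])
    show "prv (xvoc rs) (relativize Us ` map_fm Rel ` T \<union> relativize Us' ` map_fm Rel' ` T)
        (Exists (FV 1 0) (ISO rs 0))"
      using assms(2) by (simp add: internally_categorical_def)
  qed (use L.sat_relativize_theory[OF assms(1) M(3)] R.sat_relativize_theory[OF assms(1) M'(3)]
      in auto)
  then obtain f where "sat ?N e er (ef((1, 0) := f)) (ISO rs 0)"
    by (auto simp del: sum_model_simps)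
  then show ?thesis by (rule isomorphic_if_sat_ISO)
qed

end
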